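(* Let $(A,\to,\rightsquigarrow,0,1)$ be a bounded commutative pseudo BE-algebra and let $\sigma:A\to A$ be a map satisfying, for all $x,y\in A$: (E1) $x\le\sigma x$; (E2) $(\sigma(x^{-}))^{\sim}=(\sigma(x^{\sim}))^{-}$; (E3) $\sigma(x\odot(\sigma y)^{\sim})=\sigma x\odot(\sigma y)^{\sim}$ and $\sigma((\sigma x)^{-}\odot y)=(\sigma x)^{-}\odot\sigma y$; (E4) $\sigma(x\odot\sigma y)=\sigma(\sigma x\odot y)=\sigma x\odot\sigma y$; (E5) $\sigma((x^{-}\odot x^{-})^{\sim})=((\sigma x)^{-}\odot(\sigma x)^{-})^{\sim}$ and $\sigma((x^{\sim}\odot x^{\sim})^{-})=((\sigma x)^{\sim}\odot(\sigma x)^{\sim})^{-}$; (E6) $\sigma(x\odot x)=\sigma x\odot\sigma x$. Define $\forall,\exists:A\to A$ by $\exists x=\sigma x$ and $\forall x=(\sigma(x^{-}))^{\sim}=(\sigma(x^{\sim}))^{-}$ for all $x\in A$. Then $(A,\exists,\forall)$ is a monadic bounded commutative pseudo BE-algebra.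
   Context: A pseudo BE-algebra is an algebra $(A,\to,\rightsquigarrow,1)$ of type $(2,2,0)$ such that for all $x,y,z\in A$: $x\to x=x\rightsquigarrow x=1$; $x\to 1=x\rightsquigarrow 1=1$; $1\to x=1\rightsquigarrow x=x$; $x\to(y\rightsquigarrow z)=y\rightsquigarrow(x\to z)$; and $x\to y=1$ iff $x\rightsquigarrow y=1$. One writes $x\le y$ iff $x\to y=1$ (equivalently $x\rightsquigarrow y=1$). It is commutative if $(x\to y)\rightsquigarrow y=(y\to x)\rightsquigarrow x$ and $(x\rightsquigarrow y)\to y=(y\rightsquigarrow x)\to x$ for all $x,y$. It is bounded if it has an element $0$ with $0\le x$ for all $x$; then $x^{-}=x\to 0$ and $x^{\sim}=x\rightsquigarrow 0$. In a bounded commutative pseudo BE-algebra, $\le$ is a partial order, $x^{-\sim}=x^{\sim-}=x$, and one sets $x\oplus y=y^{\sim}\to x=x^{-}\rightsquigarrow y$ and $x\odot y=(x\to y^{-})^{\sim}=(y\rightsquigarrow x^{\sim})^{-}$ (which equals $\min\{z: x\le y\to z\}$ and $(y^{-}\oplus x^{-})^{\sim}=(y^{\sim}\oplus x^{\sim})^{-}$). A monadic bounded commutative pseudo BE-algebra is a bounded commutative pseudo BE-algebra with maps $\exists,\forall:A\to A$ such that for all $x,y\in A$: (M1) $x\to\exists x=x\rightsquigarrow\exists x=1$; (M2) $\forall x\to x=\forall x\rightsquigarrow x=1$; (M3) $\forall(x\to\exists y)=\exists x\to\exists y$ and $\forall(x\rightsquigarrow\exists y)=\exists x\rightsquigarrow\exists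 y$; (M4) $\forall(\exists x\to y)=\exists x\to\forall y$ and $\forall(\exists x\rightsquigarrow y)=\exists x\rightsquigarrow\forall y$; (M5) $\exists\forall x=\forall x$; (M6) $\forall(x\odot x)=\forall x\odot\forall x$; (M7) $\forall(x\oplus x)=\forall x\oplus\forall x$. *)

theory Defs
  imports "HOL-Algebra.Congruence"
begin

text \<open>The first implication is written \<open>\<rightharpoondown>\<close> because \<open>\<rightarrow>\<close> already denotes function spaces.\<close>

record 'a pseudo_BE = "'a partial_object" +
  imp  :: "'a \<Rightarrow> 'a \<Rightarrow> 'a"  (infixr \<open>\<rightharpoondown>\<index>\<close> 60)
  pimp :: "'a \<Rightarrow> 'a \<Rightarrow> 'a"  (infixr \<open>\<leadsto>\<index>\<close> 60)
  one  :: 'a  (\<open>\<one>\<index>\<close>)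

record 'a bounded_pseudo_BE = "'a pseudo_BE" +
  zero :: 'a  (\<open>\<zero>\<index>\<close>)

locale pseudo_BE_algebra =
  fixes A (structure)
  assumes imp_closed [intro, simp]:
      "\<lbrakk> x \<in> carrier A; y \<in> carrier A \<rbrakk> \<Longrightarrow> x \<rightharpoondown> y \<in> carrier A"
    and pimp_closed [intro, simp]:
      "\<lbrakk> x \<in> carrier A; y \<in> carrier A \<rbrakk> \<Longrightarrow> x \<leadsto> y \<in> carrier A"
    and one_closed [intro, simp]: "\<one> \<in> carrier A"
    and imp_self: "x \<in> carrier A \<Longrightarrow> x \<rightharpoondown> x = \<one>"
    and pimp_self: "x \<in> carrier A \<Longrightarrow> x \<leadsto> x = \<one>"
    and imp_one: "x \<in> carrier A \<Longrightarrow> x \<rightharpoondown> \<one> = \<one>"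
    and pimp_one: "x \<in> carrier A \<Longrightarrow> x \<leadsto> \<one> = \<one>"
    and one_imp: "x \<in> carrier A \<Longrightarrow> \<one> \<rightharpoondown> x = x"
    and one_pimp: "x \<in> carrier A \<Longrightarrow> \<one> \<leadsto> x = x"
    and exchange:
      "\<lbrakk> x \<in> carrier A; y \<in> carrier A; z \<in> carrier A \<rbrakk>
        \<Longrightarrow> x \<rightharpoondown> (y \<leadsto> z) = y \<leadsto> (x \<rightharpoondown> z)"
    and imp_iff_pimp:
      "\<lbrakk> x \<in> carrier A; y \<in> carrier A \<rbrakk> \<Longrightarrow> x \<rightharpoondown> y = \<one> \<longleftrightarrow> x \<leadsto> y = \<one>"

definition BE_le :: "('a, 'b) pseudo_BE_scheme \<Rightarrow> 'a \<Rightarrow> 'a \<Rightarrow> bool"  (infix \<open>\<preceq>\<index>\<close> 50)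
  where "x \<preceq>\<^bsub>A\<^esub> y \<longleftrightarrow> x \<rightharpoondown>\<^bsub>A\<^esub> y = \<one>\<^bsub>A\<^esub>"

locale commutative_pseudo_BE_algebra = pseudo_BE_algebra +
  assumes imp_pimp_commute:
      "\<lbrakk> x \<in> carrier A; y \<in> carrier A \<rbrakk>
        \<Longrightarrow> (x \<rightharpoondown> y) \<leadsto> y = (y \<rightharpoondown> x) \<leadsto> x"
    and pimp_imp_commute:
      "\<lbrakk> x \<in> carrier A; y \<in> carrier A \<rbrakk>
        \<Longrightarrow> (x \<leadsto> y) \<rightharpoondown> y = (y \<leadsto> x) \<rightharpoondown> x"

locale bounded_commutative_pseudo_BE_algebra =
  commutative_pseudo_BE_algebra A for A (structure) +
  assumes zero_closed [intro, simp]: "\<zero> \<in> carrier A"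
    and zero_le: "x \<in> carrier A \<Longrightarrow> \<zero> \<preceq> x"

definition neg :: "('a, 'b) bounded_pseudo_BE_scheme \<Rightarrow> 'a \<Rightarrow> 'a"
    (\<open>(_\<^sup>-\<index>)\<close> [1000] 1000)
  where "x\<^sup>-\<^bsub>A\<^esub> = x \<rightharpoondown>\<^bsub>A\<^esub> \<zero>\<^bsub>A\<^esub>"

definition pneg :: "('a, 'b) bounded_pseudo_BE_scheme \<Rightarrow> 'a \<Rightarrow> 'a"
    (\<open>(_\<^sup>~\<index>)\<close> [1000] 1000)
  where "x\<^sup>~\<^bsub>A\<^esub> = x \<leadsto>\<^bsub>A\<^esub> \<zero>\<^bsub>A\<^esub>"

text \<open>The equivalent formulas for \<open>\<oplus>\<close> and \<open>\<odot>\<close> that use the other implication are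
  \<open>oplus_eq\<close> and \<open>odot_eq\<close> below.\<close>

definition oplus :: "('a, 'b) bounded_pseudo_BE_scheme \<Rightarrow> 'a \<Rightarrow> 'a \<Rightarrow> 'a"
    (infixl \<open>\<oplus>\<index>\<close> 65)
  where "x \<oplus>\<^bsub>A\<^esub> y = y\<^sup>~\<^bsub>A\<^esub> \<rightharpoondown>\<^bsub>A\<^esub> x"

definition odot :: "('a, 'b) bounded_pseudo_BE_scheme \<Rightarrow> 'a \<Rightarrow> 'a \<Rightarrow> 'a"
    (infixl \<open>\<odot>\<index>\<close> 70)
  where "x \<odot>\<^bsub>A\<^esub> y = (x \<rightharpoondown>\<^bsub>A\<^esub> y\<^sup>-\<^bsub>A\<^esub>)\<^sup>~\<^bsub>A\<^esub>"

context bounded_commutative_pseudo_BE_algebra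
begin

lemma le_iff_pimp:
  "\<lbrakk> x \<in> carrier A; y \<in> carrier A \<rbrakk> \<Longrightarrow> x \<preceq> y \<longleftrightarrow> x \<leadsto> y = \<one>"
  by (simp add: BE_le_def imp_iff_pimp)

lemma neg_closed [intro, simp]: "x \<in> carrier A \<Longrightarrow> x\<^sup>- \<in> carrier A"
  by (simp add: neg_def)

lemma pneg_closed [intro, simp]: "x \<in> carrier A \<Longrightarrow> x\<^sup>~ \<in> carrier A"
  by (simp add: pneg_def)

lemma oplus_closed [intro, simp]:
  "\<lbrakk> x \<in> carrier A; y \<in> carrier A \<rbrakk> \<Longrightarrow> x \<oplus> y \<in> carrier A"
  by (simp add: oplus_def)

lemma odot_closed [intro, simp]:
  "\<lbrakk> x \<in> carrier A; y \<in> carrier A \<rbrakk> \<Longrightarrow> x \<odot> y \<in> carrier A"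
  by (simp add: odot_def)

lemma pneg_neg [simp]: "x \<in> carrier A \<Longrightarrow> x\<^sup>-\<^sup>~ = x"
  using imp_pimp_commute[of x \<zero>] zero_le[of x]
  by (simp add: neg_def pneg_def BE_le_def one_pimp)

lemma neg_pneg [simp]: "x \<in> carrier A \<Longrightarrow> x\<^sup>~\<^sup>- = x"
  using pimp_imp_commute[of x \<zero>] zero_le[of x]
  by (simp add: neg_def pneg_def le_iff_pimp one_imp)

lemma oplus_eq:
  assumes "x \<in> carrier A" "y \<in> carrier A"
  shows "x \<oplus> y = x\<^sup>- \<leadsto> y"
proof -
  have "x\<^sup>- \<leadsto> y = x\<^sup>- \<leadsto> (y\<^sup>~ \<rightharpoondown> \<zero>)"
    using assms neg_pneg[of y] by (simp add: neg_def)
  also have "\<dots> = y\<^sup>~ \<rightharpoondown> (x\<^sup>- \<leadsto> \<zero>)"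
    using assms by (simp add: exchange)
  also have "\<dots> = y\<^sup>~ \<rightharpoondown> x"
    using assms pneg_neg[of x] by (simp add: pneg_def)
  finally show ?thesis by (simp add: oplus_def)
qed

lemma le_antisym:
  "\<lbrakk> x \<in> carrier A; y \<in> carrier A; x \<preceq> y; y \<preceq> x \<rbrakk> \<Longrightarrow> x = y"
  using imp_pimp_commute[of x y] by (simp add: BE_le_def one_pimp)

lemma imp_eq_contrapos:
  assumes "x \<in> carrier A" "y \<in> carrier A"
  shows "x \<rightharpoondown> y = y\<^sup>- \<leadsto> x\<^sup>-"
proof -
  have "x \<rightharpoondown> y = x \<rightharpoondown> (y\<^sup>- \<leadsto> \<zero>)"
    using assms pneg_neg[of y] by (simp add: pneg_def)
  then show ?thesis using assms by (simp add: exchange neg_def)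
qed

lemma pimp_eq_contrapos:
  assumes "x \<in> carrier A" "y \<in> carrier A"
  shows "x \<leadsto> y = y\<^sup>~ \<rightharpoondown> x\<^sup>~"
proof -
  have "x \<leadsto> y = x \<leadsto> (y\<^sup>~ \<rightharpoondown> \<zero>)"
    using assms neg_pneg[of y] by (simp add: neg_def)
  then show ?thesis using assms by (simp add: exchange pneg_def)
qed

lemma odot_le_iff:
  assumes "x \<in> carrier A" "y \<in> carrier A" "z \<in> carrier A"
  shows "x \<odot> y \<preceq> z \<longleftrightarrow> x \<preceq> y \<rightharpoondown> z"
proof -
  have "x \<odot> y \<preceq> z \<longleftrightarrow> z\<^sup>- \<leadsto> (x \<rightharpoondown> y\<^sup>-) = \<one>"
    using assms imp_iff_pimp[of "z\<^sup>-" "x \<rightharpoondown> y\<^sup>-"]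
      pimp_eq_contrapos[of "z\<^sup>-" "x \<rightharpoondown> y\<^sup>-"] imp_iff_pimp[of "x \<odot> y" z]
    by (simp add: BE_le_def odot_def)
  also have "z\<^sup>- \<leadsto> (x \<rightharpoondown> y\<^sup>-) = x \<rightharpoondown> (y \<rightharpoondown> z)"
    using assms by (simp add: exchange[symmetric] imp_eq_contrapos[of y z])
  finally show ?thesis by (simp add: BE_le_def)
qed

lemma odot_eq_le_iff:
  assumes "x \<in> carrier A" "y \<in> carrier A" "z \<in> carrier A"
  shows "(y \<leadsto> x\<^sup>~)\<^sup>- \<preceq> z \<longleftrightarrow> x \<preceq> y \<rightharpoondown> z"
proof -
  have "(y \<leadsto> x\<^sup>~)\<^sup>- \<preceq> z \<longleftrightarrow> z\<^sup>~ \<rightharpoondown> (y \<leadsto> x\<^sup>~) = \<one>"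
    using assms imp_eq_contrapos[of "z\<^sup>~" "y \<leadsto> x\<^sup>~"]
    by (simp add: le_iff_pimp)
  also have "z\<^sup>~ \<rightharpoondown> (y \<leadsto> x\<^sup>~) = y \<leadsto> (x \<leadsto> z)"
    using assms by (simp add: exchange pimp_eq_contrapos[of x z])
  also have "y \<leadsto> (x \<leadsto> z) = \<one> \<longleftrightarrow> x \<rightharpoondown> (y \<rightharpoondown> z) = \<one>"
    using assms by (metis exchange imp_closed imp_iff_pimp pimp_closed)
  finally show ?thesis by (simp add: BE_le_def)
qed

lemma odot_eq:
  assumes "x \<in> carrier A" "y \<in> carrier A"
  shows "x \<odot> y = (y \<leadsto> x\<^sup>~)\<^sup>-"
proof (rule le_antisym)
  show "x \<odot> y \<preceq> (y \<leadsto> x\<^sup>~)\<^sup>-"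
    using assms odot_le_iff[of x y] odot_eq_le_iff[of x y "(y \<leadsto> x\<^sup>~)\<^sup>-"]
    by (simp add: BE_le_def imp_self)
  show "(y \<leadsto> x\<^sup>~)\<^sup>- \<preceq> x \<odot> y"
    using assms odot_eq_le_iff[of x y] odot_le_iff[of x y "x \<odot> y"]
    by (simp add: BE_le_def imp_self)
qed (use assms in auto)

end

text \<open>The quantifiers are functions on the whole type of which only the values on the carrier
  matter; \<open>E\<close> and \<open>U\<close> stand for the operators \<open>\<exists>\<close> and \<open>\<forall>\<close> of the algebra.\<close>

locale monadic_bounded_commutative_pseudo_BE_algebra =
  bounded_commutative_pseudo_BE_algebra A for A (structure) +
  fixes E U
  assumes E_closed: "E \<in> carrier A \<rightarrow> carrier A"
    and U_closed: "U \<in> carrier A \<rightarrow> carrier A"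
    and M1: "x \<in> carrier A \<Longrightarrow> x \<rightharpoondown> E x = \<one>"
            "x \<in> carrier A \<Longrightarrow> x \<leadsto> E x = \<one>"
    and M2: "x \<in> carrier A \<Longrightarrow> U x \<rightharpoondown> x = \<one>"
            "x \<in> carrier A \<Longrightarrow> U x \<leadsto> x = \<one>"
    and M3: "\<lbrakk> x \<in> carrier A; y \<in> carrier A \<rbrakk> \<Longrightarrow> U (x \<rightharpoondown> E y) = E x \<rightharpoondown> E y"
            "\<lbrakk> x \<in> carrier A; y \<in> carrier A \<rbrakk> \<Longrightarrow> U (x \<leadsto> E y) = E x \<leadsto> E y"
    and M4: "\<lbrakk> x \<in> carrier A; y \<in> carrier A \<rbrakk> \<Longrightarrow> U (E x \<rightharpoondown> y) = E x \<rightharpoondown> U y"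
            "\<lbrakk> x \<in> carrier A; y \<in> carrier A \<rbrakk> \<Longrightarrow> U (E x \<leadsto> y) = E x \<leadsto> U y"
    and M5: "x \<in> carrier A \<Longrightarrow> E (U x) = U x"
    and M6: "x \<in> carrier A \<Longrightarrow> U (x \<odot> x) = U x \<odot> U x"
    and M7: "x \<in> carrier A \<Longrightarrow> U (x \<oplus> x) = U x \<oplus> U x"

end

theory Submission
  imports Defs
begin

text \<open>The two negations are mutually inverse, so each implication is a negated product:
  \<open>x \<rightharpoondown> y = (x \<odot> y\<^sup>~)\<^sup>-\<close> and \<open>x \<leadsto> y = (y\<^sup>- \<odot> x)\<^sup>~\<close>. The operator \<open>U\<close> is the De Morgan
  dual of \<open>\<sigma>\<close> for either negation, because (E2) makes its two candidate definitions agree. Hence,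
  after choosing the negation that matches the implication, \<open>U\<close> of an implication is a negation of
  \<open>\<sigma>\<close> of a product. Under this translation (E3) becomes (M3), (E4) becomes (M4), (E5) becomes
  (M6), and (E6) becomes (M7); (M2) is the contrapositive of (E1). Finally (M5) is (E3) with the
  free factor equal to \<open>\<one>\<close>, which (E1) forces \<open>\<sigma>\<close> to fix.\<close>

context bounded_commutative_pseudo_BE_algebra
begin

lemma imp_eq_neg_odot:
  assumes "x \<in> carrier A" "y \<in> carrier A"
  shows "x \<rightharpoondown> y = (x \<odot> y\<^sup>~)\<^sup>-"
  using assms by (simp add: odot_def)

lemma pimp_eq_pneg_odot:
  assumes "x \<in> carrier A" "y \<in> carrier A"
  shows "x \<leadsto> y = (y\<^sup>- \<odot> x)\<^sup>~"
  using assms by (simp add: odot_eq)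

lemma oplus_eq_neg_odot:
  assumes "x \<in> carrier A" "y \<in> carrier A"
  shows "x \<oplus> y = (y\<^sup>~ \<odot> x\<^sup>~)\<^sup>-"
  using assms by (simp add: oplus_def imp_eq_neg_odot)

lemma one_odot: "x \<in> carrier A \<Longrightarrow> \<one> \<odot> x = x"
  by (simp add: odot_def one_imp)

end

theorem theorem4p13:
  fixes A :: "('a, 'b) bounded_pseudo_BE_scheme" (structure)
    and \<sigma> E U :: "'a \<Rightarrow> 'a"
  assumes "bounded_commutative_pseudo_BE_algebra A"
    and "\<sigma> \<in> carrier A \<rightarrow> carrier A"
    and E1: "\<And>x. x \<in> carrier A \<Longrightarrow> x \<preceq> \<sigma> x"
    and E2: "\<And>x. x \<in> carrier A \<Longrightarrow> (\<sigma> (x\<^sup>-))\<^sup>~ = (\<sigma> (x\<^sup>~))\<^sup>-"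
    and E3: "\<And>x y. \<lbrakk> x \<in> carrier A; y \<in> carrier A \<rbrakk> \<Longrightarrow>
               \<sigma> (x \<odot> (\<sigma> y)\<^sup>~) = \<sigma> x \<odot> (\<sigma> y)\<^sup>~"
            "\<And>x y. \<lbrakk> x \<in> carrier A; y \<in> carrier A \<rbrakk> \<Longrightarrow>
               \<sigma> ((\<sigma> x)\<^sup>- \<odot> y) = (\<sigma> x)\<^sup>- \<odot> \<sigma> y"
    and E4: "\<And>x y. \<lbrakk> x \<in> carrier A; y \<in> carrier A \<rbrakk> \<Longrightarrow>
               \<sigma> (x \<odot> \<sigma> y) = \<sigma> x \<odot> \<sigma> y"
            "\<And>x y. \<lbrakk> x \<in> carrier A; y \<in> carrier A \<rbrakk> \<Longrightarrow>
               \<sigma> (\<sigma> x \<odot> y) = \<sigma> x \<odot> \<sigma> y"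
    and E5: "\<And>x. x \<in> carrier A \<Longrightarrow>
               \<sigma> ((x\<^sup>- \<odot> x\<^sup>-)\<^sup>~) = ((\<sigma> x)\<^sup>- \<odot> (\<sigma> x)\<^sup>-)\<^sup>~"
            "\<And>x. x \<in> carrier A \<Longrightarrow>
               \<sigma> ((x\<^sup>~ \<odot> x\<^sup>~)\<^sup>-) = ((\<sigma> x)\<^sup>~ \<odot> (\<sigma> x)\<^sup>~)\<^sup>-"
    and E6: "\<And>x. x \<in> carrier A \<Longrightarrow> \<sigma> (x \<odot> x) = \<sigma> x \<odot> \<sigma> x"
    and E_def: "\<And>x. x \<in> carrier A \<Longrightarrow> E x = \<sigma> x"
    and U_def: "\<And>x. x \<in> carrier A \<Longrightarrow> U x = (\<sigma> (x\<^sup>-))\<^sup>~"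
  shows "monadic_bounded_commutative_pseudo_BE_algebra A E U"
proof -
  interpret bounded_commutative_pseudo_BE_algebra A by fact
  have \<sigma>_closed [simp]: "\<sigma> x \<in> carrier A" if "x \<in> carrier A" for x
    using \<open>\<sigma> \<in> carrier A \<rightarrow> carrier A\<close> that by auto
  have U_closed [simp]: "U x \<in> carrier A" if "x \<in> carrier A" for x
    using that by (simp add: U_def)
  have U_eq: "U x = (\<sigma> (x\<^sup>~))\<^sup>-" if "x \<in> carrier A" for x
    using that by (simp add: U_def E2)
  \<comment> \<open>Each negation needs the formula for \<open>U\<close> with the opposite inner negation, so that the two cancel.\<close>
  have U_neg: "U (x\<^sup>-) = (\<sigma> x)\<^sup>-" if "x \<in> carrier A" for x
    using that by (simp add: U_eq)
  have U_pneg: "U (x\<^sup>~) = (\<sigma> x)\<^sup>~" if "x \<in> carrier A" for x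
    using that by (simp add: U_def)
  have \<sigma>_one: "\<sigma> \<one> = \<one>"
    using E1[of \<one>] by (simp add: BE_le_def one_imp)
  show ?thesis
  proof unfold_locales
    show "E \<in> carrier A \<rightarrow> carrier A" by (simp add: E_def)
    show "U \<in> carrier A \<rightarrow> carrier A" by simp
  next
    fix x assume x: "x \<in> carrier A"
    show "x \<rightharpoondown> E x = \<one>"
      using x E1 by (simp add: E_def BE_le_def)
    then show "x \<leadsto> E x = \<one>"
      using x by (simp add: E_def imp_iff_pimp)
    have "U x \<leadsto> x = x\<^sup>~ \<rightharpoondown> \<sigma> (x\<^sup>~)"
      using x imp_eq_contrapos[of "x\<^sup>~" "\<sigma> (x\<^sup>~)"] by (simp add: U_eq)
    also have "\<dots> = \<one>"
      using x E1[of "x\<^sup>~"] by (simp add: BE_le_def)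
    finally show "U x \<leadsto> x = \<one>" .
    then show "U x \<rightharpoondown> x = \<one>"
      using x by (simp add: U_def imp_iff_pimp)
    show "E (U x) = U x"
      using x E3(1)[of \<one> "x\<^sup>-"] by (simp add: E_def U_def \<sigma>_one one_odot)
    show "U (x \<odot> x) = U x \<odot> U x"
    proof -
      have "\<sigma> ((x \<odot> x)\<^sup>~) = (U x \<odot> U x)\<^sup>~"
        using x E5(1)[of "x\<^sup>~"] by (simp add: U_eq)
      then show ?thesis
        using x by (simp add: U_eq)
    qed
    show "U (x \<oplus> x) = U x \<oplus> U x"
      using x by (simp add: oplus_eq_neg_odot U_neg E6) (simp add: U_eq)
  next
    fix x y assume xy: "x \<in> carrier A" "y \<in> carrier A"
    have "U (x \<rightharpoondown> \<sigma> y) = (\<sigma> x \<odot> (\<sigma> y)\<^sup>~)\<^sup>-"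
      using xy by (simp add: imp_eq_neg_odot U_neg E3(1))
    then show "U (x \<rightharpoondown> E y) = E x \<rightharpoondown> E y"
      using xy by (simp add: E_def imp_eq_neg_odot)
    have "U (x \<leadsto> \<sigma> y) = ((\<sigma> y)\<^sup>- \<odot> \<sigma> x)\<^sup>~"
      using xy by (simp add: pimp_eq_pneg_odot U_pneg E3(2))
    then show "U (x \<leadsto> E y) = E x \<leadsto> E y"
      using xy by (simp add: E_def pimp_eq_pneg_odot)
    have "U (\<sigma> x \<rightharpoondown> y) = (\<sigma> x \<odot> \<sigma> (y\<^sup>~))\<^sup>-"
      using xy by (simp add: imp_eq_neg_odot U_neg E4(2))
    then show "U (E x \<rightharpoondown> y) = E x \<rightharpoondown> U y"
      using xy by (simp add: E_def U_eq imp_eq_neg_odot)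
    have "U (\<sigma> x \<leadsto> y) = (\<sigma> (y\<^sup>-) \<odot> \<sigma> x)\<^sup>~"
      using xy by (simp add: pimp_eq_pneg_odot U_pneg E4(1))
    then show "U (E x \<leadsto> y) = E x \<leadsto> U y"
      using xy by (simp add: E_def U_def pimp_eq_pneg_odot)
  qed
qed

end
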